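(* Let $n\ge 1$, let $X_1,\ldots,X_n$ be nonnegative integrable real random variables (with arbitrary joint distribution), and let $\tilde X_1,\ldots,\tilde X_n$ be mutually independent random variables such that each $\tilde X_i$ has the same distribution as $X_i$. Then, with $c=\mathrm{e}/(\mathrm{e}-1)$, $$\mathbb{E}\max_{1\le i\le n}X_i\ \le\ c\,\mathbb{E}\max_{1\le i\le n}\tilde X_i.$$
   Context: Here $\mathrm{e}$ is the base of the natural logarithm. *)

theory Defs
  imports "HOL-Probability.Probability"
begin

end

theory Submission
  imports Defs
begin

text \<open>
  Both expectations are integrals of tail probabilities, so it suffices to compare tails.
  With \<open>p i = P(X i > t)\<close> and \<open>s = (\<Sum>i. p i)\<close>, the union bound gives \<open>P(max X > t) \<le> min 1 s\<close>,
  while independence gives \<open>P(max Y > t) = 1 - (\<Prod>i. 1 - p i) \<ge> 1 - exp (- s)\<close>. By concavity,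
  \<open>1 - exp (- s) \<ge> (1 - exp (- 1)) * min 1 s\<close>.
\<close>

text \<open>Layer-cake formula, by Tonelli on the region \<open>0 \<le> t \<and> t < f x\<close>. A
  signed \<open>f\<close> is allowed: \<open>ennreal\<close> cuts off negative values, which matches
  the restriction of \<open>t\<close> to \<open>{0..}\<close>.\<close>

lemma nn_integral_eq_tail_integral:
  fixes f :: "'a \<Rightarrow> real"
  assumes "sigma_finite_measure M" and [measurable]: "f \<in> borel_measurable M"
  shows "(\<integral>\<^sup>+x. ennreal (f x) \<partial>M)
    = (\<integral>\<^sup>+t. indicator {0..} t * emeasure M {x \<in> space M. t < f x} \<partial>lborel)"
proof -
  interpret sigma_finite_measure M by fact
  interpret pair_sigma_finite M lborel ..
  have "(\<integral>\<^sup>+x. ennreal (f x) \<partial>M) = (\<integral>\<^sup>+x. (\<integral>\<^sup>+t. indicator {0..<f x} t \<partial>lborel) \<partial>M)"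
  proof (intro nn_integral_cong)
    fix x
    show "ennreal (f x) = (\<integral>\<^sup>+t. indicator {0..<f x} t \<partial>lborel)"
      by (cases "0 \<le> f x") (simp_all add: ennreal_neg)
  qed
  \<comment> \<open>The indicator of a set depending on \<open>x\<close> becomes a predicate in
    \<open>(x, t)\<close>, whose joint measurability is what the exchange of integrals
    requires.\<close>
  also have "\<dots> = (\<integral>\<^sup>+x. (\<integral>\<^sup>+t. (if 0 \<le> t \<and> t < f x then 1 else 0) \<partial>lborel) \<partial>M)"
    by (intro nn_integral_cong) (auto simp: indicator_def)
  also have "\<dots> = (\<integral>\<^sup>+t. (\<integral>\<^sup>+x. (if 0 \<le> t \<and> t < f x then 1 else 0) \<partial>M) \<partial>lborel)"
    by (rule Fubini'[symmetric]) measurable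
  also have "\<dots> = (\<integral>\<^sup>+t. indicator {0..} t * emeasure M {x \<in> space M. t < f x} \<partial>lborel)"
  proof (intro nn_integral_cong)
    fix t :: real
    have "(\<integral>\<^sup>+x. (if 0 \<le> t \<and> t < f x then 1 else 0) \<partial>M)
        = (\<integral>\<^sup>+x. indicator {0..} t * indicator {x \<in> space M. t < f x} x \<partial>M)"
      by (intro nn_integral_cong) (auto simp: indicator_def)
    also have "\<dots> = indicator {0..} t * emeasure M {x \<in> space M. t < f x}"
      by (simp add: nn_integral_cmult)
    finally show "(\<integral>\<^sup>+x. (if 0 \<le> t \<and> t < f x then 1 else 0) \<partial>M)
        = indicator {0..} t * emeasure M {x \<in> space M. t < f x}" .
  qed
  finally show ?thesis .
qed

text \<open>The constant is \<open>1 / (1 - exp (- 1))\<close>. On \<open>[0, 1]\<close> the concave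
  function \<open>1 - exp (- s)\<close> lies above its chord from 0 to 1; for larger
  \<open>s\<close> monotonicity suffices.\<close>

lemma min_one_le_one_minus_exp:
  fixes s :: real
  assumes "0 \<le> s"
  shows "min 1 s \<le> exp 1 / (exp 1 - 1) * (1 - exp (- s))"
proof -
  have "(1 - exp (- 1)) * min 1 s \<le> 1 - exp (- s)"
  proof (cases "s \<le> 1")
    case True
    \<comment> \<open>The point \<open>- s\<close> is the convex combination of 0 and -1 with
      weights \<open>1 - s\<close> and \<open>s\<close>.\<close>
    have "exp ((1 - s) *\<^sub>R 0 + s *\<^sub>R (- 1)) \<le> (1 - s) * exp 0 + s * exp (- 1 :: real)"
      using assms True by (intro convex_onD[OF exp_convex]) auto
    then show ?thesis
      using True by (simp add: algebra_simps)
  next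
    case False
    then show ?thesis by simp
  qed
  moreover have "1 < exp (1 :: real)" by simp
  ultimately show ?thesis
    by (simp add: exp_minus field_simps)
qed

lemma (in prob_space) prob_Max_gt_le_sum:
  fixes X :: "'i \<Rightarrow> 'a \<Rightarrow> real"
  assumes I: "finite I" "I \<noteq> {}" and [measurable]: "\<And>i. i \<in> I \<Longrightarrow> random_variable borel (X i)"
  shows "prob {\<omega> \<in> space M. t < Max ((\<lambda>i. X i \<omega>) ` I)}
    \<le> (\<Sum>i\<in>I. prob {\<omega> \<in> space M. t < X i \<omega>})"
proof -
  have "{\<omega> \<in> space M. t < Max ((\<lambda>i. X i \<omega>) ` I)} = (\<Union>i\<in>I. {\<omega> \<in> space M. t < X i \<omega>})"
    using I by (auto simp: Max_gr_iff)
  moreover have "prob (\<Union>i\<in>I. {\<omega> \<in> space M. t < X i \<omega>}) \<le> (\<Sum>i\<in>I. prob {\<omega> \<in> space M. t < X i \<omega>})"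
    using I by (intro finite_measure_subadditive_finite) auto
  ultimately show ?thesis by simp
qed

text \<open>Independence applies to the complement: the maximum is at most \<open>t\<close> iff
  every \<open>Y i\<close> is, so this probability factorizes, and each factor satisfies
  \<open>1 - x \<le> exp (- x)\<close>.\<close>

lemma (in prob_space) prob_Max_gt_indep:
  fixes Y :: "'i \<Rightarrow> 'a \<Rightarrow> real"
  assumes I: "finite I" "I \<noteq> {}" and ind: "indep_vars (\<lambda>_. borel) Y I"
  shows "1 - exp (- (\<Sum>i\<in>I. prob {\<omega> \<in> space M. t < Y i \<omega>}))
    \<le> prob {\<omega> \<in> space M. t < Max ((\<lambda>i. Y i \<omega>) ` I)}"
proof -
  have [measurable]: "\<And>i. i \<in> I \<Longrightarrow> random_variable borel (Y i)"
    using ind by (simp add: indep_vars_def)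
  have "{\<omega> \<in> space M. \<not> t < Max ((\<lambda>i. Y i \<omega>) ` I)} = (\<Inter>i\<in>I. Y i -` {..t} \<inter> space M)"
    using I by (auto simp: Max_gr_iff not_less)
  then have "prob {\<omega> \<in> space M. \<not> t < Max ((\<lambda>i. Y i \<omega>) ` I)} = (\<Prod>i\<in>I. prob (Y i -` {..t} \<inter> space M))"
    using indep_varsD[OF ind I(2,1) order_refl, of "\<lambda>_. {..t}"] by simp
  also have "\<dots> = (\<Prod>i\<in>I. 1 - prob {\<omega> \<in> space M. t < Y i \<omega>})"
  proof (intro prod.cong refl)
    fix i assume [simp]: "i \<in> I"
    have "Y i -` {..t} \<inter> space M = {\<omega> \<in> space M. \<not> t < Y i \<omega>}" by auto
    then show "prob (Y i -` {..t} \<inter> space M) = 1 - prob {\<omega> \<in> space M. t < Y i \<omega>}"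
      by (simp add: prob_neg)
  qed
  \<comment> \<open>Comparing the products factor by factor also uses that each
    \<open>1 - prob\<close> is nonnegative.\<close>
  also have "\<dots> \<le> (\<Prod>i\<in>I. exp (- prob {\<omega> \<in> space M. t < Y i \<omega>}))"
    using exp_ge_add_one_self[of "- x" for x :: real] by (intro prod_mono) simp
  also have "\<dots> = exp (- (\<Sum>i\<in>I. prob {\<omega> \<in> space M. t < Y i \<omega>}))"
    using I by (simp add: exp_sum flip: sum_negf)
  finally show ?thesis
    using I by (subst (asm) prob_neg) auto
qed

lemma integrable_Max:
  fixes f :: "'i \<Rightarrow> 'a \<Rightarrow> real"
  assumes "finite I" "I \<noteq> {}" "\<And>i. i \<in> I \<Longrightarrow> integrable M (f i)"
  shows "integrable M (\<lambda>x. Max ((\<lambda>i. f i x) ` I))"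
  using assms
proof (induction rule: finite_ne_induct)
  case (insert i I)
  then have "integrable M (\<lambda>x. max (f i x) (Max ((\<lambda>i. f i x) ` I)))"
    by (intro integrable_max) auto
  with insert show ?case by simp
qed simp

text \<open>A single nonnegative entry suffices, since the maximum dominates it.\<close>

lemma AE_Max_nonneg:
  fixes f :: "'i \<Rightarrow> 'a \<Rightarrow> real"
  assumes "finite I" "i \<in> I" "AE x in M. 0 \<le> f i x"
  shows "AE x in M. 0 \<le> Max ((\<lambda>i. f i x) ` I)"
  using assms(3) by (rule eventually_mono) (use assms(1,2) in \<open>auto intro: order_trans Max_ge\<close>)

theorem proposition3:
  fixes n :: nat
    and M :: "'a measure" and N :: "'b measure"
    and X :: "nat \<Rightarrow> 'a \<Rightarrow> real" and Y :: "nat \<Rightarrow> 'b \<Rightarrow> real"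
  assumes "n \<ge> 1"
    and "prob_space M" and "prob_space N"
    and "\<And>i. i \<in> {1..n} \<Longrightarrow> integrable M (X i)"
    and "\<And>i. i \<in> {1..n} \<Longrightarrow> AE \<omega> in M. X i \<omega> \<ge> 0"
    and "prob_space.indep_vars N (\<lambda>_. borel) Y {1..n}"
    and "\<And>i. i \<in> {1..n} \<Longrightarrow> distr N borel (Y i) = distr M borel (X i)"
  shows "(\<integral>\<omega>. Max ((\<lambda>i. X i \<omega>) ` {1..n}) \<partial>M)
    \<le> exp 1 / (exp 1 - 1) * (\<integral>\<omega>. Max ((\<lambda>i. Y i \<omega>) ` {1..n}) \<partial>N)"
proof -
  interpret M: prob_space M by fact
  interpret N: prob_space N by fact
  let ?I = "{1..n}"
  let ?MX = "\<lambda>\<omega>. Max ((\<lambda>i. X i \<omega>) ` ?I)" and ?MY = "\<lambda>\<omega>. Max ((\<lambda>i. Y i \<omega>) ` ?I)"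
  define c :: real where "c = exp 1 / (exp 1 - 1)"
  have c: "0 \<le> c" by (simp add: c_def)
  have I: "finite ?I" "?I \<noteq> {}" "1 \<in> ?I" using assms(1) by auto
  have X [measurable]: "\<And>i. i \<in> ?I \<Longrightarrow> X i \<in> borel_measurable M"
    using assms(4) by blast
  have Y [measurable]: "\<And>i. i \<in> ?I \<Longrightarrow> Y i \<in> borel_measurable N"
    using assms(6) by (simp add: N.indep_vars_def)
  \<comment> \<open>Integrability, almost sure nonnegativity and tails depend only on the law, so
    all three pass between \<open>X i\<close> and \<open>Y i\<close> through the equality of
    \<open>distr\<close>.\<close>
  have Yint: "integrable N (Y i)" if "i \<in> ?I" for i
  proof -
    have "integrable (distr M borel (X i)) (\<lambda>x. x)"
      using X[OF that] assms(4)[OF that] by (simp add: integrable_distr_eq)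
    then show ?thesis
      using Y[OF that] assms(7)[OF that, symmetric] by (simp add: integrable_distr_eq)
  qed
  have Ynonneg: "AE \<omega> in N. 0 \<le> Y i \<omega>" if "i \<in> ?I" for i
  proof -
    have "AE x in distr M borel (X i). 0 \<le> x"
      using X[OF that] assms(5)[OF that] by (simp add: AE_distr_iff)
    then have "AE x in distr N borel (Y i). 0 \<le> x"
      unfolding assms(7)[OF that] .
    then show ?thesis
      using Y[OF that] by (simp add: AE_distr_iff)
  qed
  have tail_eq: "N.prob {\<omega> \<in> space N. t < Y i \<omega>} = M.prob {\<omega> \<in> space M. t < X i \<omega>}"
    if "i \<in> ?I" for i t
  proof -
    have "measure (distr N borel (Y i)) {t<..} = measure (distr M borel (X i)) {t<..}"
      using assms(7)[OF that] by simp
    moreover have "Y i -` {t<..} \<inter> space N = {\<omega> \<in> space N. t < Y i \<omega>}"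
      "X i -` {t<..} \<inter> space M = {\<omega> \<in> space M. t < X i \<omega>}" by auto
    ultimately show ?thesis
      using X[OF that] Y[OF that] by (simp add: measure_distr)
  qed
  have tail_le: "M.prob {\<omega> \<in> space M. t < ?MX \<omega>} \<le> c * N.prob {\<omega> \<in> space N. t < ?MY \<omega>}" for t
  proof -
    let ?s = "\<Sum>i\<in>?I. M.prob {\<omega> \<in> space M. t < X i \<omega>}"
    have s: "(\<Sum>i\<in>?I. N.prob {\<omega> \<in> space N. t < Y i \<omega>}) = ?s"
      by (rule sum.cong[OF refl tail_eq])
    \<comment> \<open>The 1 is the trivial bound on a probability, \<open>?s\<close> the union
      bound, valid under any dependence.\<close>
    have "M.prob {\<omega> \<in> space M. t < ?MX \<omega>} \<le> min 1 ?s"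
      using M.prob_Max_gt_le_sum[OF I(1,2) X] by simp
    also have "\<dots> \<le> c * (1 - exp (- ?s))"
      unfolding c_def by (intro min_one_le_one_minus_exp sum_nonneg) simp
    also have "\<dots> \<le> c * N.prob {\<omega> \<in> space N. t < ?MY \<omega>}"
      using N.prob_Max_gt_indep[OF I(1,2) assms(6), of t] c
      unfolding s by (rule mult_left_mono)
    finally show ?thesis .
  qed
  \<comment> \<open>A Bochner integral defaults to 0 without integrability; with it and
    nonnegativity, both expectations agree with their \<open>ennreal\<close> versions.\<close>
  have intX: "integrable M ?MX" and intY: "integrable N ?MY"
    using I assms(4) Yint by (auto intro!: integrable_Max)
  have nonnegX: "AE \<omega> in M. 0 \<le> ?MX \<omega>" and nonnegY: "AE \<omega> in N. 0 \<le> ?MY \<omega>"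
    by (rule AE_Max_nonneg[OF I(1,3)], fact assms(5)[OF I(3)] Ynonneg[OF I(3)])+
  have [measurable]: "?MX \<in> borel_measurable M" "?MY \<in> borel_measurable N"
    using intX intY by auto
  have "ennreal (\<integral>\<omega>. ?MX \<omega> \<partial>M) = (\<integral>\<^sup>+\<omega>. ?MX \<omega> \<partial>M)"
    using nn_integral_eq_integral[OF intX nonnegX] by simp
  also have "\<dots> = (\<integral>\<^sup>+t. indicator {0..} t * emeasure M {\<omega> \<in> space M. t < ?MX \<omega>} \<partial>lborel)"
    by (intro nn_integral_eq_tail_integral) (auto intro: M.sigma_finite_measure_axioms)
  \<comment> \<open>The tail bound holds for each \<open>t\<close> with the same \<open>c\<close>,
    so it can be integrated.\<close>
  also have "\<dots> \<le> (\<integral>\<^sup>+t. ennreal c * (indicator {0..} t * emeasure N {\<omega> \<in> space N. t < ?MY \<omega>}) \<partial>lborel)"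
    using tail_le c
    by (intro nn_integral_mono)
      (auto simp: M.emeasure_eq_measure N.emeasure_eq_measure ennreal_mult' [symmetric]
        split: split_indicator)
  also have "\<dots> = ennreal c * (\<integral>\<^sup>+t. indicator {0..} t * emeasure N {\<omega> \<in> space N. t < ?MY \<omega>} \<partial>lborel)"
    by (intro nn_integral_cmult) measurable
  also have "\<dots> = ennreal c * (\<integral>\<^sup>+\<omega>. ?MY \<omega> \<partial>N)"
    by (subst nn_integral_eq_tail_integral) (auto intro: N.sigma_finite_measure_axioms)
  also have "\<dots> = ennreal (c * (\<integral>\<omega>. ?MY \<omega> \<partial>N))"
    using nn_integral_eq_integral[OF intY nonnegY] c by (simp add: ennreal_mult')
  \<comment> \<open>Returning from \<open>ennreal\<close> to the reals needs the right-hand side to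
    be nonnegative.\<close>
  finally show ?thesis
    using c integral_nonneg_AE[OF nonnegY] by (simp add: c_def)
qed

end
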